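(* Let $S$ be a $\Gamma$-semigroup and let $\chi_S$ be the characteristic function of $S$ (the constant function $1$ on $S$). The following conditions are equivalent: (1) $S$ is regular; (2) for every fuzzy right ideal $\mu$ and every fuzzy left ideal $\lambda$ of $S$, $\mu\circ\lambda=\mu\cap\lambda$; (3) for every fuzzy right ideal $\mu$ and every fuzzy left ideal $\lambda$ of $S$: (a) $\mu\circ\mu=\mu$, (b) $\lambda\circ\lambda=\lambda$, (c) $\mu\circ\lambda$ is a fuzzy quasi ideal of $S$; (4) every fuzzy quasi ideal $\delta$ of $S$ satisfies $\delta=\delta\circ\chi_S\circ\delta$.
   Context: Let $S$ and $\Gamma$ be non-empty sets. $S$ is a $\Gamma$-semigroup if there is a map $S\times\Gamma\times S\to S$, written $(a,\alpha,b)\mapsto a\alpha b$, with $(x\beta y)\gamma z=x\beta(y\gamma z)$ for all $x,y,z\in S$, $\beta,\gamma\in\Gamma$. $S$ is regular if for each $a\in S$ there exist $x\in S$ and $\alpha,\beta\in\Gamma$ with $a=a\alpha x\beta a$. A fuzzy subset of $S$ is a function $\mu:S\to[0,1]$; it is non-empty if it is not identically $0$. For fuzzy subsets $\mu,\sigma$ of $S$: $(\mu\cap\sigma)(x)=\min\{\mu(x),\sigma(x)\}$; $(\mu\circ\sigma)(x)=\sup\{\min\{\mu(y),\sigma(z)\}: y,z\in S,\gamma\in\Gamma,\ x=y\gamma z\}$ if $x$ can be written as $y\gamma z$, and $(\mu\circ\sigma)(x)=0$ otherwise; $\mu\subseteq\sigma$ means $\mu(x)\le\sigma(x)$ for all $x\in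 S$. The operation $\circ$ is associative. A non-empty fuzzy subset $\mu$ is a fuzzy left ideal if $\mu(x\gamma y)\ge\mu(y)$ for all $x,y\in S,\gamma\in\Gamma$; a fuzzy right ideal if $\mu(x\gamma y)\ge\mu(x)$ for all $x,y\in S,\gamma\in\Gamma$; and a fuzzy quasi ideal if $(\mu\circ\chi_S)\cap(\chi_S\circ\mu)\subseteq\mu$. *)

theory Defs
  imports Complex_Main "HOL-Library.FuncSet"
begin

locale gamma_semigroup =
  fixes S :: "'a set" and \<Gamma> :: "'g set" and m :: "'a \<Rightarrow> 'g \<Rightarrow> 'a \<Rightarrow> 'a"
  assumes S_nonempty: "S \<noteq> {}"
    and \<Gamma>_nonempty: "\<Gamma> \<noteq> {}"
    and closed: "\<lbrakk>x \<in> S; \<gamma> \<in> \<Gamma>; y \<in> S\<rbrakk> \<Longrightarrow> m x \<gamma> y \<in> S"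
    and assoc: "\<lbrakk>x \<in> S; y \<in> S; z \<in> S; \<beta> \<in> \<Gamma>; \<gamma> \<in> \<Gamma>\<rbrakk>
                  \<Longrightarrow> m (m x \<beta> y) \<gamma> z = m x \<beta> (m y \<gamma> z)"

definition gs_regular :: "'a set \<Rightarrow> 'g set \<Rightarrow> ('a \<Rightarrow> 'g \<Rightarrow> 'a \<Rightarrow> 'a) \<Rightarrow> bool" where
  "gs_regular S \<Gamma> m \<longleftrightarrow>
     (\<forall>a\<in>S. \<exists>x\<in>S. \<exists>\<alpha>\<in>\<Gamma>. \<exists>\<beta>\<in>\<Gamma>. a = m (m a \<alpha> x) \<beta> a)"

(* Fuzzy subsets are extensional functions on the carrier (equal to undefined outside S),
   so that HOL equality of fuzzy subsets is equality of functions from S to [0,1]. *)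
definition fuzzy_subset :: "'a set \<Rightarrow> ('a \<Rightarrow> real) \<Rightarrow> bool" where
  "fuzzy_subset S \<mu> \<longleftrightarrow> \<mu> \<in> S \<rightarrow>\<^sub>E {0..1}"

definition fuzzy_nonempty :: "'a set \<Rightarrow> ('a \<Rightarrow> real) \<Rightarrow> bool" where
  "fuzzy_nonempty S \<mu> \<longleftrightarrow> (\<exists>x\<in>S. \<mu> x \<noteq> 0)"

definition fuzzy_chi :: "'a set \<Rightarrow> 'a \<Rightarrow> real" where
  "fuzzy_chi S = (\<lambda>x\<in>S. 1)"

definition fuzzy_le :: "'a set \<Rightarrow> ('a \<Rightarrow> real) \<Rightarrow> ('a \<Rightarrow> real) \<Rightarrow> bool" where
  "fuzzy_le S \<mu> \<sigma> \<longleftrightarrow> (\<forall>x\<in>S. \<mu> x \<le> \<sigma> x)"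

definition fuzzy_inter :: "'a set \<Rightarrow> ('a \<Rightarrow> real) \<Rightarrow> ('a \<Rightarrow> real) \<Rightarrow> 'a \<Rightarrow> real" where
  "fuzzy_inter S \<mu> \<sigma> = (\<lambda>x\<in>S. min (\<mu> x) (\<sigma> x))"

(* For fuzzy subsets, the set under Sup is bounded by 1, and the case distinction
   guarantees that it is non-empty. *)
definition fuzzy_comp ::
  "'a set \<Rightarrow> 'g set \<Rightarrow> ('a \<Rightarrow> 'g \<Rightarrow> 'a \<Rightarrow> 'a) \<Rightarrow> ('a \<Rightarrow> real) \<Rightarrow> ('a \<Rightarrow> real) \<Rightarrow> 'a \<Rightarrow> real" where
  "fuzzy_comp S \<Gamma> m \<mu> \<sigma> = (\<lambda>x\<in>S.
     if \<exists>y\<in>S. \<exists>\<gamma>\<in>\<Gamma>. \<exists>z\<in>S. x = m y \<gamma> z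
     then Sup {min (\<mu> y) (\<sigma> z) | y \<gamma> z. y \<in> S \<and> \<gamma> \<in> \<Gamma> \<and> z \<in> S \<and> x = m y \<gamma> z}
     else 0)"

definition fuzzy_left_ideal ::
  "'a set \<Rightarrow> 'g set \<Rightarrow> ('a \<Rightarrow> 'g \<Rightarrow> 'a \<Rightarrow> 'a) \<Rightarrow> ('a \<Rightarrow> real) \<Rightarrow> bool" where
  "fuzzy_left_ideal S \<Gamma> m \<mu> \<longleftrightarrow> fuzzy_subset S \<mu> \<and> fuzzy_nonempty S \<mu> \<and>
     (\<forall>x\<in>S. \<forall>y\<in>S. \<forall>\<gamma>\<in>\<Gamma>. \<mu> (m x \<gamma> y) \<ge> \<mu> y)"

definition fuzzy_right_ideal ::
  "'a set \<Rightarrow> 'g set \<Rightarrow> ('a \<Rightarrow> 'g \<Rightarrow> 'a \<Rightarrow> 'a) \<Rightarrow> ('a \<Rightarrow> real) \<Rightarrow> bool" where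
  "fuzzy_right_ideal S \<Gamma> m \<mu> \<longleftrightarrow> fuzzy_subset S \<mu> \<and> fuzzy_nonempty S \<mu> \<and>
     (\<forall>x\<in>S. \<forall>y\<in>S. \<forall>\<gamma>\<in>\<Gamma>. \<mu> (m x \<gamma> y) \<ge> \<mu> x)"

definition fuzzy_quasi_ideal ::
  "'a set \<Rightarrow> 'g set \<Rightarrow> ('a \<Rightarrow> 'g \<Rightarrow> 'a \<Rightarrow> 'a) \<Rightarrow> ('a \<Rightarrow> real) \<Rightarrow> bool" where
  "fuzzy_quasi_ideal S \<Gamma> m \<mu> \<longleftrightarrow> fuzzy_subset S \<mu> \<and> fuzzy_nonempty S \<mu> \<and>
     fuzzy_le S (fuzzy_inter S (fuzzy_comp S \<Gamma> m \<mu> (fuzzy_chi S))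
                               (fuzzy_comp S \<Gamma> m (fuzzy_chi S) \<mu>)) \<mu>"

end

(* If S is regular, writing x = (x \<alpha> y) \<beta> x exhibits the factorisations that bound the fuzzy
   products from below. Conversely, it suffices to work with characteristic functions: with R and
   L the principal right and left ideals of a, each of the conditions (2), (3), (4) yields
   a \<in> R \<Gamma> L, and a factorisation of a as (a or a \<gamma> s) times (a or t \<delta> a) makes a regular. *)
theory Submission
  imports Defs
begin

context gamma_semigroup
begin

section \<open>Fuzzy subsets as extensional functions into the unit interval\<close>

lemma fuzzy_subset_bounds:
  assumes "fuzzy_subset S \<mu>" "x \<in> S"
  shows "0 \<le> \<mu> x" "\<mu> x \<le> 1"
  using assms unfolding fuzzy_subset_def by (auto simp: PiE_iff)

text \<open>Outside \<open>S\<close> both functions are \<open>undefined\<close>, so agreement on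
  the carrier is already equality in HOL. In this way two pointwise inequalities on \<open>S\<close>
  prove each equation between fuzzy products.\<close>

lemma fuzzy_subset_eqI:
  assumes "fuzzy_subset S \<mu>" "fuzzy_subset S \<sigma>" "\<And>x. x \<in> S \<Longrightarrow> \<mu> x = \<sigma> x"
  shows "\<mu> = \<sigma>"
  using assms PiE_ext unfolding fuzzy_subset_def by blast

lemma fuzzy_chi_subset: "fuzzy_subset S (fuzzy_chi S)"
  by (simp add: fuzzy_subset_def fuzzy_chi_def)

lemma fuzzy_chi_apply: "x \<in> S \<Longrightarrow> fuzzy_chi S x = 1"
  by (simp add: fuzzy_chi_def)

lemma fuzzy_inter_apply: "x \<in> S \<Longrightarrow> fuzzy_inter S \<mu> \<sigma> x = min (\<mu> x) (\<sigma> x)"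
  by (simp add: fuzzy_inter_def)

lemma fuzzy_inter_subset:
  assumes "fuzzy_subset S \<mu>" "fuzzy_subset S \<sigma>"
  shows "fuzzy_subset S (fuzzy_inter S \<mu> \<sigma>)"
  using fuzzy_subset_bounds[OF assms(1)] fuzzy_subset_bounds[OF assms(2)]
  unfolding fuzzy_inter_def fuzzy_subset_def[of S "restrict _ S"] by (auto simp: min_le_iff_disj)

section \<open>Bounds for the fuzzy product\<close>

lemma fuzzy_comp_ge:
  assumes "fuzzy_subset S \<mu>" "fuzzy_subset S \<sigma>" "y \<in> S" "\<gamma> \<in> \<Gamma>" "z \<in> S"
  shows "min (\<mu> y) (\<sigma> z) \<le> fuzzy_comp S \<Gamma> m \<mu> \<sigma> (m y \<gamma> z)"
proof -
  let ?A = "{min (\<mu> y') (\<sigma> z') | y' \<gamma>' z'.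
    y' \<in> S \<and> \<gamma>' \<in> \<Gamma> \<and> z' \<in> S \<and> m y \<gamma> z = m y' \<gamma>' z'}"
  \<comment> \<open>A supremum of reals dominates the members only of a bounded set; 1 is a bound,
    since each minimum is at most a value of \<mu>.\<close>
  have "bdd_above ?A"
    using fuzzy_subset_bounds(2)[OF assms(1)] by (intro bdd_aboveI[of _ 1]) (auto simp: min_le_iff_disj)
  then have "min (\<mu> y) (\<sigma> z) \<le> Sup ?A"
    using assms by (intro cSup_upper) auto
  moreover have "\<exists>y'\<in>S. \<exists>\<gamma>'\<in>\<Gamma>. \<exists>z'\<in>S. m y \<gamma> z = m y' \<gamma>' z'"
    using assms by blast
  ultimately show ?thesis
    using assms closed by (simp add: fuzzy_comp_def)
qed

text \<open>The assumption \<open>0 \<le> c\<close> covers an \<open>x\<close> without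
  factorisation, where the product has the default value 0. Otherwise the bound on each
  factorisation passes to the supremum.\<close>

lemma fuzzy_comp_le:
  assumes "x \<in> S" "0 \<le> c"
    and "\<And>y \<gamma> z. \<lbrakk>y \<in> S; \<gamma> \<in> \<Gamma>; z \<in> S; x = m y \<gamma> z\<rbrakk> \<Longrightarrow> min (\<mu> y) (\<sigma> z) \<le> c"
  shows "fuzzy_comp S \<Gamma> m \<mu> \<sigma> x \<le> c"
proof (cases "\<exists>y\<in>S. \<exists>\<gamma>\<in>\<Gamma>. \<exists>z\<in>S. x = m y \<gamma> z")
  case True
  then have "Sup {min (\<mu> y) (\<sigma> z) | y \<gamma> z. y \<in> S \<and> \<gamma> \<in> \<Gamma> \<and> z \<in> S \<and> x = m y \<gamma> z} \<le> c"
    by (intro cSup_least) (use assms(3) in auto)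
  with True assms(1) show ?thesis
    unfolding fuzzy_comp_def by simp
qed (use assms in \<open>simp add: fuzzy_comp_def\<close>)

text \<open>This leads back from suprema to elements: if no factorisation had a positive minimum,
  \<open>fuzzy_comp_le\<close> with the bound 0 would contradict positivity. The supremum need not
  be attained.\<close>

lemma fuzzy_comp_posE:
  assumes "0 < fuzzy_comp S \<Gamma> m \<mu> \<sigma> x" "x \<in> S"
  obtains y \<gamma> z where "y \<in> S" "\<gamma> \<in> \<Gamma>" "z \<in> S" "x = m y \<gamma> z" "0 < \<mu> y" "0 < \<sigma> z"
proof -
  have "\<exists>y \<gamma> z. y \<in> S \<and> \<gamma> \<in> \<Gamma> \<and> z \<in> S \<and> x = m y \<gamma> z \<and> \<not> min (\<mu> y) (\<sigma> z) \<le> 0"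
    using fuzzy_comp_le[OF assms(2), of 0 \<mu> \<sigma>] assms(1) by (meson leD order_refl)
  then show ?thesis
    using that by (auto simp: min_le_iff_disj not_le)
qed

lemma fuzzy_comp_subset:
  assumes "fuzzy_subset S \<mu>" "fuzzy_subset S \<sigma>"
  shows "fuzzy_subset S (fuzzy_comp S \<Gamma> m \<mu> \<sigma>)"
proof -
  \<comment> \<open>A single factorisation bounds the supremum from below by a non-negative number;
    without one, the default value is 0.\<close>
  have "0 \<le> fuzzy_comp S \<Gamma> m \<mu> \<sigma> x" if "x \<in> S" for x
  proof (cases "\<exists>y\<in>S. \<exists>\<gamma>\<in>\<Gamma>. \<exists>z\<in>S. x = m y \<gamma> z")
    case True
    then obtain y \<gamma> z where yz: "y \<in> S" "\<gamma> \<in> \<Gamma>" "z \<in> S" "x = m y \<gamma> z" by blast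
    have "0 \<le> min (\<mu> y) (\<sigma> z)"
      using fuzzy_subset_bounds(1) assms yz by simp
    also have "\<dots> \<le> fuzzy_comp S \<Gamma> m \<mu> \<sigma> x"
      using fuzzy_comp_ge[OF assms yz(1-3)] yz(4) by simp
    finally show ?thesis .
  qed (use that in \<open>simp add: fuzzy_comp_def\<close>)
  moreover have "fuzzy_comp S \<Gamma> m \<mu> \<sigma> x \<le> 1" if "x \<in> S" for x
    using that fuzzy_subset_bounds(2)[OF assms(1)]
    by (intro fuzzy_comp_le) (auto simp: min_le_iff_disj)
  moreover have "fuzzy_comp S \<Gamma> m \<mu> \<sigma> x = undefined" if "x \<notin> S" for x
    using that by (simp add: fuzzy_comp_def)
  ultimately show ?thesis
    by (auto simp: fuzzy_subset_def PiE_iff extensional_def)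
qed

section \<open>Products with one-sided ideals, and quasi ideals as intersections\<close>

lemma fuzzy_right_ideal_comp_le:
  assumes "fuzzy_right_ideal S \<Gamma> m \<mu>" "x \<in> S"
  shows "fuzzy_comp S \<Gamma> m \<mu> \<sigma> x \<le> \<mu> x"
  using assms fuzzy_subset_bounds(1)
  by (intro fuzzy_comp_le) (auto simp: fuzzy_right_ideal_def min_le_iff_disj)

lemma fuzzy_left_ideal_comp_le:
  assumes "fuzzy_left_ideal S \<Gamma> m \<nu>" "x \<in> S"
  shows "fuzzy_comp S \<Gamma> m \<sigma> \<nu> x \<le> \<nu> x"
  using assms fuzzy_subset_bounds(1)
  by (intro fuzzy_comp_le) (auto simp: fuzzy_left_ideal_def min_le_iff_disj)

text \<open>This half of \<mu> \<circ> \<nu> = \<mu> \<inter> \<nu> holds in every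
  \<Gamma>-semigroup; regularity enters only in the reverse inequality.\<close>

lemma fuzzy_ideals_comp_le_inter:
  assumes "fuzzy_right_ideal S \<Gamma> m \<mu>" "fuzzy_left_ideal S \<Gamma> m \<nu>" "x \<in> S"
  shows "fuzzy_comp S \<Gamma> m \<mu> \<nu> x \<le> fuzzy_inter S \<mu> \<nu> x"
  using fuzzy_right_ideal_comp_le[OF assms(1,3)] fuzzy_left_ideal_comp_le[OF assms(2,3)] assms(3)
  by (simp add: fuzzy_inter_apply)

lemma fuzzy_comp_mono:
  assumes "fuzzy_subset S \<mu>'" "fuzzy_subset S \<sigma>'" "x \<in> S"
    and "\<And>y. y \<in> S \<Longrightarrow> \<mu> y \<le> \<mu>' y" "\<And>y. y \<in> S \<Longrightarrow> \<sigma> y \<le> \<sigma>' y"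
  shows "fuzzy_comp S \<Gamma> m \<mu> \<sigma> x \<le> fuzzy_comp S \<Gamma> m \<mu>' \<sigma>' x"
proof (rule fuzzy_comp_le[OF assms(3)])
  show "0 \<le> fuzzy_comp S \<Gamma> m \<mu>' \<sigma>' x"
    using fuzzy_comp_subset fuzzy_subset_bounds(1) assms by blast
  fix y \<gamma> z assume yz: "y \<in> S" "\<gamma> \<in> \<Gamma>" "z \<in> S" "x = m y \<gamma> z"
  have "min (\<mu> y) (\<sigma> z) \<le> min (\<mu>' y) (\<sigma>' z)"
    using assms(4,5) yz by (intro min.mono) auto
  also have "\<dots> \<le> fuzzy_comp S \<Gamma> m \<mu>' \<sigma>' x"
    using fuzzy_comp_ge[OF assms(1,2) yz(1-3)] yz(4) by simp
  finally show "min (\<mu> y) (\<sigma> z) \<le> fuzzy_comp S \<Gamma> m \<mu>' \<sigma>' x" .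
qed

text \<open>Monotonicity puts (\<mu> \<inter> \<nu>) \<circ> \<chi> below \<mu> \<circ> \<chi>,
  hence below \<mu>, and \<chi> \<circ> (\<mu> \<inter> \<nu>) below \<chi> \<circ> \<nu>, hence
  below \<nu>. The result serves twice: to show that \<mu> \<circ> \<nu> is a quasi ideal when
  \<open>S\<close> is regular, and to build the test object for the condition on quasi
  ideals.\<close>

lemma fuzzy_quasi_ideal_inter:
  assumes \<mu>: "fuzzy_right_ideal S \<Gamma> m \<mu>" and \<nu>: "fuzzy_left_ideal S \<Gamma> m \<nu>"
  shows "fuzzy_quasi_ideal S \<Gamma> m (fuzzy_inter S \<mu> \<nu>)"
proof -
  have sub: "fuzzy_subset S \<mu>" "fuzzy_subset S \<nu>"
    using assms by (auto simp: fuzzy_right_ideal_def fuzzy_left_ideal_def)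
  \<comment> \<open>The supports of \<mu> and \<nu> meet in \<open>m p \<gamma> q\<close>: its left
    factor keeps the right ideal \<mu> positive, its right factor the left ideal \<nu>.\<close>
  obtain p q where pq: "p \<in> S" "\<mu> p \<noteq> 0" "q \<in> S" "\<nu> q \<noteq> 0"
    using assms by (auto simp: fuzzy_right_ideal_def fuzzy_left_ideal_def fuzzy_nonempty_def)
  obtain \<gamma> where \<gamma>: "\<gamma> \<in> \<Gamma>" using \<Gamma>_nonempty by blast
  have "0 < \<mu> p" "0 < \<nu> q"
    using pq fuzzy_subset_bounds(1)[OF sub(1), of p] fuzzy_subset_bounds(1)[OF sub(2), of q] by auto
  moreover have "\<mu> p \<le> \<mu> (m p \<gamma> q)" "\<nu> q \<le> \<nu> (m p \<gamma> q)"
    using assms pq \<gamma> by (auto simp: fuzzy_right_ideal_def fuzzy_left_ideal_def)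
  ultimately have "fuzzy_inter S \<mu> \<nu> (m p \<gamma> q) \<noteq> 0"
    using closed pq \<gamma> by (simp add: fuzzy_inter_apply min_def)
  then have "fuzzy_nonempty S (fuzzy_inter S \<mu> \<nu>)"
    using closed pq \<gamma> unfolding fuzzy_nonempty_def by blast
  moreover have "fuzzy_comp S \<Gamma> m (fuzzy_inter S \<mu> \<nu>) (fuzzy_chi S) x \<le> \<mu> x"
    "fuzzy_comp S \<Gamma> m (fuzzy_chi S) (fuzzy_inter S \<mu> \<nu>) x \<le> \<nu> x" if "x \<in> S" for x
    using that
    by (auto intro!: order_trans[OF fuzzy_comp_mono fuzzy_right_ideal_comp_le[OF \<mu>]]
        order_trans[OF fuzzy_comp_mono fuzzy_left_ideal_comp_le[OF \<nu>]]
        simp: sub fuzzy_chi_subset fuzzy_inter_apply)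
  ultimately show ?thesis
    using fuzzy_inter_subset[OF sub]
    by (auto simp: fuzzy_quasi_ideal_def fuzzy_le_def fuzzy_inter_apply min_le_iff_disj
        intro!: min.mono)
qed

section \<open>Consequences of regularity\<close>

lemma regularE:
  assumes "gs_regular S \<Gamma> m" "a \<in> S"
  obtains x \<alpha> \<beta> where "x \<in> S" "\<alpha> \<in> \<Gamma>" "\<beta> \<in> \<Gamma>" "a = m (m a \<alpha> x) \<beta> a" "a = m a \<alpha> (m x \<beta> a)"
  using assms assoc unfolding gs_regular_def by metis

text \<open>In x = (x \<alpha> y) \<beta> x the left factor has \<mu>-value at least \<mu> x, as
  \<mu> is a right ideal, and the right factor is x itself, with value \<nu> x.\<close>

lemma regular_comp_eq_inter:
  assumes reg: "gs_regular S \<Gamma> m"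
    and \<mu>: "fuzzy_right_ideal S \<Gamma> m \<mu>" and \<nu>: "fuzzy_left_ideal S \<Gamma> m \<nu>"
  shows "fuzzy_comp S \<Gamma> m \<mu> \<nu> = fuzzy_inter S \<mu> \<nu>"
proof -
  have sub: "fuzzy_subset S \<mu>" "fuzzy_subset S \<nu>"
    using \<mu> \<nu> by (auto simp: fuzzy_right_ideal_def fuzzy_left_ideal_def)
  have "fuzzy_inter S \<mu> \<nu> x \<le> fuzzy_comp S \<Gamma> m \<mu> \<nu> x" if "x \<in> S" for x
  proof -
    obtain y \<alpha> \<beta> where y: "y \<in> S" "\<alpha> \<in> \<Gamma>" "\<beta> \<in> \<Gamma>" "x = m (m x \<alpha> y) \<beta> x"
      using regularE[OF reg \<open>x \<in> S\<close>] .
    have "fuzzy_inter S \<mu> \<nu> x \<le> min (\<mu> (m x \<alpha> y)) (\<nu> x)"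
      using \<mu> y(1,2) that by (auto simp: fuzzy_inter_apply fuzzy_right_ideal_def min_le_iff_disj)
    also have "\<dots> \<le> fuzzy_comp S \<Gamma> m \<mu> \<nu> x"
      using fuzzy_comp_ge[OF sub, of "m x \<alpha> y" \<beta> x] y that closed by simp
    finally show ?thesis .
  qed
  then show ?thesis
    using fuzzy_ideals_comp_le_inter[OF \<mu> \<nu>]
    by (intro fuzzy_subset_eqI fuzzy_comp_subset fuzzy_inter_subset sub antisym)
qed

text \<open>Both factors of x = (x \<alpha> y) \<beta> x have value at least \<mu> x.\<close>

lemma regular_right_ideal_idem:
  assumes reg: "gs_regular S \<Gamma> m" and \<mu>: "fuzzy_right_ideal S \<Gamma> m \<mu>"
  shows "fuzzy_comp S \<Gamma> m \<mu> \<mu> = \<mu>"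
proof -
  have sub: "fuzzy_subset S \<mu>"
    using \<mu> by (simp add: fuzzy_right_ideal_def)
  have "\<mu> x \<le> fuzzy_comp S \<Gamma> m \<mu> \<mu> x" if "x \<in> S" for x
  proof -
    obtain y \<alpha> \<beta> where y: "y \<in> S" "\<alpha> \<in> \<Gamma>" "\<beta> \<in> \<Gamma>" "x = m (m x \<alpha> y) \<beta> x"
      using regularE[OF reg \<open>x \<in> S\<close>] .
    have "\<mu> x \<le> min (\<mu> (m x \<alpha> y)) (\<mu> x)"
      using \<mu> y that by (simp add: fuzzy_right_ideal_def)
    also have "\<dots> \<le> fuzzy_comp S \<Gamma> m \<mu> \<mu> x"
      using fuzzy_comp_ge[OF sub sub, of "m x \<alpha> y" \<beta> x] y that closed by simp
    finally show ?thesis .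
  qed
  then show ?thesis
    using fuzzy_right_ideal_comp_le[OF \<mu>]
    by (intro fuzzy_subset_eqI fuzzy_comp_subset sub antisym)
qed

text \<open>Here the other bracketing x = x \<alpha> (y \<beta> x) is the suitable one: a left ideal
  controls a product through its right factor.\<close>

lemma regular_left_ideal_idem:
  assumes reg: "gs_regular S \<Gamma> m" and \<nu>: "fuzzy_left_ideal S \<Gamma> m \<nu>"
  shows "fuzzy_comp S \<Gamma> m \<nu> \<nu> = \<nu>"
proof -
  have sub: "fuzzy_subset S \<nu>"
    using \<nu> by (simp add: fuzzy_left_ideal_def)
  have "\<nu> x \<le> fuzzy_comp S \<Gamma> m \<nu> \<nu> x" if "x \<in> S" for x
  proof -
    obtain y \<alpha> \<beta> where y: "y \<in> S" "\<alpha> \<in> \<Gamma>" "\<beta> \<in> \<Gamma>" "x = m x \<alpha> (m y \<beta> x)"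
      using regularE[OF reg \<open>x \<in> S\<close>] .
    have "\<nu> x \<le> min (\<nu> x) (\<nu> (m y \<beta> x))"
      using \<nu> y that by (simp add: fuzzy_left_ideal_def)
    also have "\<dots> \<le> fuzzy_comp S \<Gamma> m \<nu> \<nu> x"
      using fuzzy_comp_ge[OF sub sub, of x \<alpha> "m y \<beta> x"] y that closed by simp
    finally show ?thesis .
  qed
  then show ?thesis
    using fuzzy_left_ideal_comp_le[OF \<nu>]
    by (intro fuzzy_subset_eqI fuzzy_comp_subset sub antisym)
qed

text \<open>A factorisation u = p \<beta> q turns into u \<gamma> z = p \<beta> (q \<gamma> z) with
  the same left factor, and \<chi> is 1 at both right factors. So \<delta> \<circ> \<chi> satisfies
  the inequality of a right ideal.\<close>

lemma fuzzy_comp_chi_mult: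
  assumes "fuzzy_subset S \<delta>" "u \<in> S" "\<gamma> \<in> \<Gamma>" "z \<in> S"
  shows "fuzzy_comp S \<Gamma> m \<delta> (fuzzy_chi S) u \<le> fuzzy_comp S \<Gamma> m \<delta> (fuzzy_chi S) (m u \<gamma> z)"
proof (rule fuzzy_comp_le[OF assms(2)])
  show "0 \<le> fuzzy_comp S \<Gamma> m \<delta> (fuzzy_chi S) (m u \<gamma> z)"
    using fuzzy_subset_bounds(1)[OF fuzzy_comp_subset[OF assms(1) fuzzy_chi_subset]] assms closed
    by blast
  fix p \<beta> q assume "p \<in> S" "\<beta> \<in> \<Gamma>" "q \<in> S" "u = m p \<beta> q"
  then show "min (\<delta> p) (fuzzy_chi S q) \<le> fuzzy_comp S \<Gamma> m \<delta> (fuzzy_chi S) (m u \<gamma> z)"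
    using fuzzy_comp_ge[OF assms(1) fuzzy_chi_subset, of p \<beta> "m q \<gamma> z"] assms closed
    by (simp add: assoc fuzzy_chi_apply)
qed

lemma regular_quasi_ideal_eq:
  assumes reg: "gs_regular S \<Gamma> m" and \<delta>: "fuzzy_quasi_ideal S \<Gamma> m \<delta>"
  shows "\<delta> = fuzzy_comp S \<Gamma> m (fuzzy_comp S \<Gamma> m \<delta> (fuzzy_chi S)) \<delta>"
proof -
  let ?\<delta>\<chi> = "fuzzy_comp S \<Gamma> m \<delta> (fuzzy_chi S)" and ?\<chi>\<delta> = "fuzzy_comp S \<Gamma> m (fuzzy_chi S) \<delta>"
  have sub: "fuzzy_subset S \<delta>"
    using \<delta> by (simp add: fuzzy_quasi_ideal_def)
  note sub\<delta>\<chi> = fuzzy_comp_subset[OF sub fuzzy_chi_subset]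
    and sub\<chi>\<delta> = fuzzy_comp_subset[OF fuzzy_chi_subset sub]
  have "\<delta> x \<le> fuzzy_comp S \<Gamma> m ?\<delta>\<chi> \<delta> x" if "x \<in> S" for x
  proof -
    obtain y \<alpha> \<beta> where y: "y \<in> S" "\<alpha> \<in> \<Gamma>" "\<beta> \<in> \<Gamma>" "x = m (m x \<alpha> y) \<beta> x"
      using regularE[OF reg \<open>x \<in> S\<close>] .
    \<comment> \<open>The factorisation of \<open>m x \<alpha> y\<close> into \<open>x\<close> and
      \<open>y\<close> contributes the minimum of \<delta> x and 1.\<close>
    have "\<delta> x \<le> ?\<delta>\<chi> (m x \<alpha> y)"
      using fuzzy_comp_ge[OF sub fuzzy_chi_subset, of x \<alpha> y] fuzzy_subset_bounds(2)[OF sub] y that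
      by (simp add: fuzzy_chi_apply)
    then have "\<delta> x \<le> min (?\<delta>\<chi> (m x \<alpha> y)) (\<delta> x)" by simp
    also have "\<dots> \<le> fuzzy_comp S \<Gamma> m ?\<delta>\<chi> \<delta> x"
      using fuzzy_comp_ge[OF sub\<delta>\<chi> sub, of "m x \<alpha> y" \<beta> x] y that closed by simp
    finally show ?thesis .
  qed
  \<comment> \<open>The triple product lies below \<delta> \<circ> \<chi>, which does not decrease
    under multiplication on the right, and below \<chi> \<circ> \<delta>, because \<delta> \<circ>
    \<chi> is at most \<chi>. The quasi ideal condition bounds the minimum of the two by
    \<delta>.\<close>
  moreover have "fuzzy_comp S \<Gamma> m ?\<delta>\<chi> \<delta> x \<le> \<delta> x" if "x \<in> S" for x
  proof -
    have "fuzzy_comp S \<Gamma> m ?\<delta>\<chi> \<delta> x \<le> ?\<delta>\<chi> x"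
      using that fuzzy_comp_chi_mult[OF sub] fuzzy_subset_bounds(1)[OF sub\<delta>\<chi>]
      by (intro fuzzy_comp_le) (auto simp: min_le_iff_disj)
    moreover have "fuzzy_comp S \<Gamma> m ?\<delta>\<chi> \<delta> x \<le> ?\<chi>\<delta> x"
      using that fuzzy_subset_bounds(2)[OF sub\<delta>\<chi>]
      by (intro fuzzy_comp_mono fuzzy_chi_subset sub) (auto simp: fuzzy_chi_apply)
    moreover have "min (?\<delta>\<chi> x) (?\<chi>\<delta> x) \<le> \<delta> x"
      using \<delta> that by (auto simp: fuzzy_quasi_ideal_def fuzzy_le_def fuzzy_inter_apply)
    ultimately show ?thesis by linarith
  qed
  ultimately show ?thesis
    by (intro fuzzy_subset_eqI fuzzy_comp_subset sub fuzzy_chi_subset antisym)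
qed

section \<open>Principal one-sided ideals and their characteristic functions\<close>

definition fuzzy_indicator :: "'a set \<Rightarrow> 'a \<Rightarrow> real" where
  "fuzzy_indicator A = (\<lambda>x\<in>S. of_bool (x \<in> A))"

text \<open>The element \<open>a\<close> is adjoined because the set of products of \<open>a\<close>
  with elements of \<open>S\<close> need not contain it.\<close>

definition principal_right :: "'a \<Rightarrow> 'a set" where
  "principal_right a = insert a {m a \<gamma> s | \<gamma> s. \<gamma> \<in> \<Gamma> \<and> s \<in> S}"

definition principal_left :: "'a \<Rightarrow> 'a set" where
  "principal_left a = insert a {m s \<gamma> a | \<gamma> s. \<gamma> \<in> \<Gamma> \<and> s \<in> S}"

lemma fuzzy_indicator_apply: "x \<in> S \<Longrightarrow> fuzzy_indicator A x = of_bool (x \<in> A)"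
  by (simp add: fuzzy_indicator_def)

lemma fuzzy_indicator_subset: "fuzzy_subset S (fuzzy_indicator A)"
  by (simp add: fuzzy_subset_def fuzzy_indicator_def)

lemma principal_right_mult:
  assumes "a \<in> S" "x \<in> principal_right a" "\<gamma> \<in> \<Gamma>" "y \<in> S"
  shows "m x \<gamma> y \<in> principal_right a"
proof -
  from assms(2) consider "x = a" | \<epsilon> s where "\<epsilon> \<in> \<Gamma>" "s \<in> S" "x = m a \<epsilon> s"
    unfolding principal_right_def by blast
  then show ?thesis
  proof cases
    case 2
    then have "m x \<gamma> y = m a \<epsilon> (m s \<gamma> y)" "m s \<gamma> y \<in> S" using assms closed by (auto simp: assoc)
    then show ?thesis using 2 unfolding principal_right_def by blast
  qed (use assms in \<open>auto simp: principal_right_def\<close>)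
qed

lemma principal_left_mult:
  assumes "a \<in> S" "x \<in> principal_left a" "\<gamma> \<in> \<Gamma>" "y \<in> S"
  shows "m y \<gamma> x \<in> principal_left a"
proof -
  from assms(2) consider "x = a" | \<epsilon> s where "\<epsilon> \<in> \<Gamma>" "s \<in> S" "x = m s \<epsilon> a"
    unfolding principal_left_def by blast
  then show ?thesis
  proof cases
    case 2
    then have "m y \<gamma> x = m (m y \<gamma> s) \<epsilon> a" "m y \<gamma> s \<in> S" using assms closed by (auto simp: assoc)
    then show ?thesis using 2 unfolding principal_left_def by blast
  qed (use assms in \<open>auto simp: principal_left_def\<close>)
qed

lemma fuzzy_right_ideal_principal:
  assumes "a \<in> S"
  shows "fuzzy_right_ideal S \<Gamma> m (fuzzy_indicator (principal_right a))"
proof -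
  have "a \<in> principal_right a" by (simp add: principal_right_def)
  then show ?thesis
    using assms closed principal_right_mult[OF assms] fuzzy_indicator_subset
    by (force simp: fuzzy_right_ideal_def fuzzy_nonempty_def fuzzy_indicator_apply)
qed

lemma fuzzy_left_ideal_principal:
  assumes "a \<in> S"
  shows "fuzzy_left_ideal S \<Gamma> m (fuzzy_indicator (principal_left a))"
proof -
  have "a \<in> principal_left a" by (simp add: principal_left_def)
  then show ?thesis
    using assms closed principal_left_mult[OF assms] fuzzy_indicator_subset
    by (force simp: fuzzy_left_ideal_def fuzzy_nonempty_def fuzzy_indicator_apply)
qed

section \<open>From each condition back to regularity\<close>

lemma regular_if_principal_product:
  assumes "\<And>a. a \<in> S \<Longrightarrow> \<exists>p\<in>principal_right a. \<exists>\<gamma>\<in>\<Gamma>. \<exists>q\<in>principal_left a. a = m p \<gamma> q"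
  shows "gs_regular S \<Gamma> m"
  unfolding gs_regular_def
proof
  fix a assume a: "a \<in> S"
  then obtain p \<gamma> q where pq: "p \<in> principal_right a" "\<gamma> \<in> \<Gamma>" "q \<in> principal_left a" "a = m p \<gamma> q"
    using assms by blast
  \<comment> \<open>The middle element that witnesses regularity is \<open>a\<close>,
    \<open>t\<close>, \<open>s\<close> and \<open>m s \<gamma> t\<close> in turn. In the first case
    a = a \<gamma> a is substituted into its own left factor.\<close>
  consider "p = a" "q = a"
    | t \<delta> where "p = a" "t \<in> S" "\<delta> \<in> \<Gamma>" "q = m t \<delta> a"
    | s \<epsilon> where "s \<in> S" "\<epsilon> \<in> \<Gamma>" "p = m a \<epsilon> s" "q = a"
    | s \<epsilon> t \<delta> where "s \<in> S" "\<epsilon> \<in> \<Gamma>" "p = m a \<epsilon> s" "t \<in> S" "\<delta> \<in> \<Gamma>" "q = m t \<delta> a"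
    using pq unfolding principal_right_def principal_left_def by blast
  then show "\<exists>x\<in>S. \<exists>\<alpha>\<in>\<Gamma>. \<exists>\<beta>\<in>\<Gamma>. a = m (m a \<alpha> x) \<beta> a"
  proof cases
    case 1
    then have "a = m a \<gamma> a" using pq(4) by blast
    then have "a = m (m a \<gamma> a) \<gamma> a" by metis
    then show ?thesis using a pq(2) by blast
  next
    case 2
    then have "m p \<gamma> q = m (m a \<gamma> t) \<delta> a" using pq(2) a by (simp add: assoc)
    then show ?thesis using 2(2,3) pq(2,4) by metis
  next
    case 3
    then show ?thesis using pq(2,4) by blast
  next
    case 4
    then have "m p \<gamma> q = m (m a \<epsilon> (m s \<gamma> t)) \<delta> a" using pq(2) a closed by (simp add: assoc)
    then show ?thesis using 4(1,2,4,5) pq(2,4) closed by metis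
  qed
qed

lemma indicator_comp_posE:
  assumes "0 < fuzzy_comp S \<Gamma> m (fuzzy_indicator A) (fuzzy_indicator B) x" "x \<in> S"
  obtains y \<gamma> z where "y \<in> S" "\<gamma> \<in> \<Gamma>" "z \<in> S" "x = m y \<gamma> z" "y \<in> A" "z \<in> B"
proof -
  obtain y \<gamma> z where "y \<in> S" "\<gamma> \<in> \<Gamma>" "z \<in> S" "x = m y \<gamma> z"
      "0 < fuzzy_indicator A y" "0 < fuzzy_indicator B z"
    using fuzzy_comp_posE[OF assms] .
  then show ?thesis
    using that by (simp add: fuzzy_indicator_apply)
qed

lemma indicator_comp_ge:
  assumes "y \<in> S" "\<gamma> \<in> \<Gamma>" "z \<in> S" "y \<in> A" "z \<in> B"
  shows "1 \<le> fuzzy_comp S \<Gamma> m (fuzzy_indicator A) (fuzzy_indicator B) (m y \<gamma> z)"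
  using fuzzy_comp_ge[OF fuzzy_indicator_subset fuzzy_indicator_subset assms(1-3), of A B] assms
  by (simp add: fuzzy_indicator_apply)

text \<open>Both indicators are 1 at \<open>a\<close>, so the assumed equation makes their product
  positive there, and positivity yields a factorisation of \<open>a\<close> through the two
  principal ideals.\<close>

lemma regular_if_comp_eq_inter:
  assumes "\<And>\<mu> \<nu>. \<lbrakk>fuzzy_right_ideal S \<Gamma> m \<mu>; fuzzy_left_ideal S \<Gamma> m \<nu>\<rbrakk>
    \<Longrightarrow> fuzzy_comp S \<Gamma> m \<mu> \<nu> = fuzzy_inter S \<mu> \<nu>"
  shows "gs_regular S \<Gamma> m"
proof (rule regular_if_principal_product)
  fix a assume a: "a \<in> S"
  have "a \<in> principal_right a" "a \<in> principal_left a"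
    by (auto simp: principal_right_def principal_left_def)
  then have "0 < fuzzy_comp S \<Gamma> m (fuzzy_indicator (principal_right a))
      (fuzzy_indicator (principal_left a)) a"
    using assms[OF fuzzy_right_ideal_principal fuzzy_left_ideal_principal, OF a a] a
    by (simp add: fuzzy_inter_apply fuzzy_indicator_apply)
  then show "\<exists>p\<in>principal_right a. \<exists>\<gamma>\<in>\<Gamma>. \<exists>q\<in>principal_left a. a = m p \<gamma> q"
    using indicator_comp_posE a by metis
qed

text \<open>Two applications of idempotence place \<open>a\<close> in R \<Gamma> L \<Gamma> S and,
  symmetrically, in S \<Gamma> R \<Gamma> L. The quasi ideal condition for the product of the
  indicators then gives a \<in> R \<Gamma> L.\<close>

lemma regular_if_idem_quasi:
  assumes "\<And>\<mu> \<nu>. \<lbrakk>fuzzy_right_ideal S \<Gamma> m \<mu>; fuzzy_left_ideal S \<Gamma> m \<nu>\<rbrakk>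
    \<Longrightarrow> fuzzy_comp S \<Gamma> m \<mu> \<mu> = \<mu> \<and> fuzzy_comp S \<Gamma> m \<nu> \<nu> = \<nu> \<and>
        fuzzy_quasi_ideal S \<Gamma> m (fuzzy_comp S \<Gamma> m \<mu> \<nu>)"
  shows "gs_regular S \<Gamma> m"
proof (rule regular_if_principal_product)
  fix a assume a: "a \<in> S"
  let ?R = "principal_right a" and ?L = "principal_left a"
  let ?RL = "fuzzy_comp S \<Gamma> m (fuzzy_indicator ?R) (fuzzy_indicator ?L)"
  have aR: "a \<in> ?R" and aL: "a \<in> ?L"
    by (auto simp: principal_right_def principal_left_def)
  note hyp = assms[OF fuzzy_right_ideal_principal fuzzy_left_ideal_principal, OF a a]
  \<comment> \<open>For indicators, idempotence says that every element of R is a product of two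
    elements of R; likewise for L below.\<close>
  have RR: "\<exists>y\<in>S \<inter> ?R. \<exists>\<gamma>\<in>\<Gamma>. \<exists>z\<in>S \<inter> ?R. x = m y \<gamma> z" if "x \<in> S" "x \<in> ?R" for x
  proof -
    have "0 < fuzzy_comp S \<Gamma> m (fuzzy_indicator ?R) (fuzzy_indicator ?R) x"
      using hyp that by (simp add: fuzzy_indicator_apply)
    then show ?thesis
      by (rule indicator_comp_posE[OF _ that(1)]) blast
  qed
  have LL: "\<exists>y\<in>S \<inter> ?L. \<exists>\<gamma>\<in>\<Gamma>. \<exists>z\<in>S \<inter> ?L. x = m y \<gamma> z" if "x \<in> S" "x \<in> ?L" for x
  proof -
    have "0 < fuzzy_comp S \<Gamma> m (fuzzy_indicator ?L) (fuzzy_indicator ?L) x"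
      using hyp that by (simp add: fuzzy_indicator_apply)
    then show ?thesis
      by (rule indicator_comp_posE[OF _ that(1)]) blast
  qed
  have subRL: "fuzzy_subset S ?RL"
    by (intro fuzzy_comp_subset fuzzy_indicator_subset)
  \<comment> \<open>\<open>a \<in> R \<Gamma> R \<Gamma> R\<close>, and the middle factor is \<open>a\<close> or \<open>a \<epsilon> s\<close> with \<open>a \<in> L\<close>.\<close>
  have "\<exists>r\<in>S \<inter> ?R. \<exists>\<gamma>\<in>\<Gamma>. \<exists>\<epsilon>\<in>\<Gamma>. \<exists>w\<in>S. a = m (m r \<gamma> a) \<epsilon> w"
  proof -
    obtain r1 \<gamma> r where r1: "r1 \<in> S" "r1 \<in> ?R" "\<gamma> \<in> \<Gamma>" "r \<in> S" "r \<in> ?R" "a = m r1 \<gamma> r"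
      using RR[OF a aR] by blast
    obtain r2 \<delta> r3 where r: "r2 \<in> S" "r2 \<in> ?R" "\<delta> \<in> \<Gamma>" "r3 \<in> S" "r = m r2 \<delta> r3"
      using RR[of r] r1 by blast
    from \<open>r2 \<in> ?R\<close> consider "r2 = a" | \<epsilon> s where "\<epsilon> \<in> \<Gamma>" "s \<in> S" "r2 = m a \<epsilon> s"
      unfolding principal_right_def by blast
    then show ?thesis
    proof cases
      case 1
      then have "m r1 \<gamma> r = m (m r1 \<gamma> a) \<delta> r3" using r1(1-5) r a by (simp add: assoc)
      then show ?thesis using r1 r(3,4) by (metis IntI)
    next
      case 2
      then have "m r1 \<gamma> r = m (m r1 \<gamma> a) \<epsilon> (m s \<delta> r3)"
        using r1(1-5) r a closed by (simp add: assoc)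
      then show ?thesis using r1 r(3,4) 2(1,2) closed by (metis IntI)
    qed
  qed
  then obtain r \<gamma> \<epsilon> w where "r \<in> S" "r \<in> ?R" "\<gamma> \<in> \<Gamma>" "\<epsilon> \<in> \<Gamma>" "w \<in> S" "a = m (m r \<gamma> a) \<epsilon> w"
    by blast
  \<comment> \<open>As r \<in> R and a \<in> L, the product \<open>?RL\<close> is at least 1 at
    \<open>m r \<gamma> a\<close>, and \<chi> is 1 at \<open>w\<close>.\<close>
  then have right: "1 \<le> fuzzy_comp S \<Gamma> m ?RL (fuzzy_chi S) a"
    using fuzzy_comp_ge[OF subRL fuzzy_chi_subset, of "m r \<gamma> a" \<epsilon> w] a closed aL
      indicator_comp_ge[of r \<gamma> a ?R ?L]
    by (simp add: fuzzy_chi_apply)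
  \<comment> \<open>The mirror image: a \<in> L \<Gamma> L \<Gamma> L with middle factor
    \<open>a\<close> or \<open>m s \<epsilon> a\<close>. This \<open>a\<close> is now used as an
    element of R, and \<open>s\<close> is absorbed into \<open>w\<close>.\<close>
  have "\<exists>l\<in>S \<inter> ?L. \<exists>\<gamma>\<in>\<Gamma>. \<exists>\<epsilon>\<in>\<Gamma>. \<exists>w\<in>S. a = m w \<epsilon> (m a \<gamma> l)"
  proof -
    obtain l \<gamma> l3 where l3: "l3 \<in> S" "l3 \<in> ?L" "\<gamma> \<in> \<Gamma>" "l \<in> S" "l \<in> ?L" "a = m l \<gamma> l3"
      using LL[OF a aL] by blast
    obtain l1 \<delta> l2 where l: "l2 \<in> S" "l2 \<in> ?L" "\<delta> \<in> \<Gamma>" "l1 \<in> S" "l = m l1 \<delta> l2"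
      using LL[of l] l3 by blast
    from \<open>l2 \<in> ?L\<close> consider "l2 = a" | \<epsilon> s where "\<epsilon> \<in> \<Gamma>" "s \<in> S" "l2 = m s \<epsilon> a"
      unfolding principal_left_def by blast
    then show ?thesis
    proof cases
      case 1
      then have "m l \<gamma> l3 = m l1 \<delta> (m a \<gamma> l3)" using l3(1-5) l a by (simp add: assoc)
      then show ?thesis using l3 l(3,4) by (metis IntI)
    next
      case 2
      then have "m l \<gamma> l3 = m (m l1 \<delta> s) \<epsilon> (m a \<gamma> l3)"
        using l3(1-5) l a closed by (simp add: assoc)
      then show ?thesis using l3 l(3,4) 2(1,2) closed by (metis IntI)
    qed
  qed
  then obtain l \<gamma> \<epsilon> w where "l \<in> S" "l \<in> ?L" "\<gamma> \<in> \<Gamma>" "\<epsilon> \<in> \<Gamma>" "w \<in> S" "a = m w \<epsilon> (m a \<gamma> l)"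
    by blast
  then have left: "1 \<le> fuzzy_comp S \<Gamma> m (fuzzy_chi S) ?RL a"
    using fuzzy_comp_ge[OF fuzzy_chi_subset subRL, of w \<epsilon> "m a \<gamma> l"] a closed aR
      indicator_comp_ge[of a \<gamma> l ?R ?L]
    by (simp add: fuzzy_chi_apply)
  \<comment> \<open>Both products with \<chi> are at least 1 at \<open>a\<close>, so the quasi ideal
    inequality forces \<open>?RL\<close> to be at least 1 there.\<close>
  have "fuzzy_inter S (fuzzy_comp S \<Gamma> m ?RL (fuzzy_chi S)) (fuzzy_comp S \<Gamma> m (fuzzy_chi S) ?RL) a
      \<le> ?RL a"
    using hyp a unfolding fuzzy_quasi_ideal_def fuzzy_le_def by blast
  then have "0 < ?RL a"
    using left right a by (simp add: fuzzy_inter_apply)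
  then show "\<exists>p\<in>?R. \<exists>\<gamma>\<in>\<Gamma>. \<exists>q\<in>?L. a = m p \<gamma> q"
    using indicator_comp_posE a by metis
qed

text \<open>The test object is the intersection of the indicators of R and L, a quasi ideal with
  value 1 at \<open>a\<close>. Unfolding the positive triple product gives a = (p \<delta> q)
  \<gamma> z with p \<in> R and z \<in> L; R absorbs \<open>q\<close>, so p \<delta> q is the left
  factor sought.\<close>

lemma regular_if_quasi_ideal_eq:
  assumes "\<And>\<delta>. fuzzy_quasi_ideal S \<Gamma> m \<delta>
    \<Longrightarrow> \<delta> = fuzzy_comp S \<Gamma> m (fuzzy_comp S \<Gamma> m \<delta> (fuzzy_chi S)) \<delta>"
  shows "gs_regular S \<Gamma> m"
proof (rule regular_if_principal_product)
  fix a assume a: "a \<in> S"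
  let ?R = "principal_right a" and ?L = "principal_left a"
  let ?Q = "fuzzy_inter S (fuzzy_indicator ?R) (fuzzy_indicator ?L)"
  have "a \<in> ?R" "a \<in> ?L"
    by (auto simp: principal_right_def principal_left_def)
  then have "?Q a = 1"
    using a by (simp add: fuzzy_inter_apply fuzzy_indicator_apply)
  moreover have "?Q = fuzzy_comp S \<Gamma> m (fuzzy_comp S \<Gamma> m ?Q (fuzzy_chi S)) ?Q"
    by (intro assms fuzzy_quasi_ideal_inter fuzzy_right_ideal_principal fuzzy_left_ideal_principal a)
  ultimately have "0 < fuzzy_comp S \<Gamma> m (fuzzy_comp S \<Gamma> m ?Q (fuzzy_chi S)) ?Q a"
    by simp
  then obtain y \<gamma> z where yz: "y \<in> S" "\<gamma> \<in> \<Gamma>" "z \<in> S" "a = m y \<gamma> z"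
      "0 < fuzzy_comp S \<Gamma> m ?Q (fuzzy_chi S) y" "0 < ?Q z"
    using fuzzy_comp_posE a by metis
  obtain p \<delta> q where pq: "p \<in> S" "\<delta> \<in> \<Gamma>" "q \<in> S" "y = m p \<delta> q" "0 < ?Q p"
    using fuzzy_comp_posE[OF yz(5,1)] by metis
  have "p \<in> ?R" "z \<in> ?L"
    using yz pq by (auto simp: fuzzy_inter_apply fuzzy_indicator_apply)
  then have "y \<in> ?R"
    using principal_right_mult a pq by blast
  then show "\<exists>p\<in>?R. \<exists>\<gamma>\<in>\<Gamma>. \<exists>q\<in>?L. a = m p \<gamma> q"
    using yz \<open>z \<in> ?L\<close> by blast
qed

end

section \<open>Assembly of the three equivalences with regularity\<close>

theorem theorem5p13:
  fixes S :: "'a set" and \<Gamma> :: "'g set" and m :: "'a \<Rightarrow> 'g \<Rightarrow> 'a \<Rightarrow> 'a"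
  assumes "gamma_semigroup S \<Gamma> m"
  shows "(gs_regular S \<Gamma> m \<longleftrightarrow>
           (\<forall>\<mu> \<nu>. fuzzy_right_ideal S \<Gamma> m \<mu> \<and> fuzzy_left_ideal S \<Gamma> m \<nu> \<longrightarrow>
              fuzzy_comp S \<Gamma> m \<mu> \<nu> = fuzzy_inter S \<mu> \<nu>))
       \<and> (gs_regular S \<Gamma> m \<longleftrightarrow>
           (\<forall>\<mu> \<nu>. fuzzy_right_ideal S \<Gamma> m \<mu> \<and> fuzzy_left_ideal S \<Gamma> m \<nu> \<longrightarrow>
              fuzzy_comp S \<Gamma> m \<mu> \<mu> = \<mu> \<and>
              fuzzy_comp S \<Gamma> m \<nu> \<nu> = \<nu> \<and>
              fuzzy_quasi_ideal S \<Gamma> m (fuzzy_comp S \<Gamma> m \<mu> \<nu>)))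
       \<and> (gs_regular S \<Gamma> m \<longleftrightarrow>
           (\<forall>\<delta>. fuzzy_quasi_ideal S \<Gamma> m \<delta> \<longrightarrow>
              \<delta> = fuzzy_comp S \<Gamma> m (fuzzy_comp S \<Gamma> m \<delta> (fuzzy_chi S)) \<delta>))"
proof -
  interpret gamma_semigroup S \<Gamma> m by (rule assms)
  show ?thesis
  proof (intro conjI iffI)
    assume reg: "gs_regular S \<Gamma> m"
    show "\<forall>\<mu> \<nu>. fuzzy_right_ideal S \<Gamma> m \<mu> \<and> fuzzy_left_ideal S \<Gamma> m \<nu> \<longrightarrow>
        fuzzy_comp S \<Gamma> m \<mu> \<nu> = fuzzy_inter S \<mu> \<nu>"
      using regular_comp_eq_inter[OF reg] by blast
    \<comment> \<open>For the quasi ideal claim, regularity rewrites the product as an intersection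
      of a right and a left ideal.\<close>
    show "\<forall>\<mu> \<nu>. fuzzy_right_ideal S \<Gamma> m \<mu> \<and> fuzzy_left_ideal S \<Gamma> m \<nu> \<longrightarrow>
        fuzzy_comp S \<Gamma> m \<mu> \<mu> = \<mu> \<and> fuzzy_comp S \<Gamma> m \<nu> \<nu> = \<nu> \<and>
        fuzzy_quasi_ideal S \<Gamma> m (fuzzy_comp S \<Gamma> m \<mu> \<nu>)"
      by (simp add: regular_comp_eq_inter[OF reg] regular_right_ideal_idem[OF reg]
          regular_left_ideal_idem[OF reg] fuzzy_quasi_ideal_inter)
    show "\<forall>\<delta>. fuzzy_quasi_ideal S \<Gamma> m \<delta> \<longrightarrow>
        \<delta> = fuzzy_comp S \<Gamma> m (fuzzy_comp S \<Gamma> m \<delta> (fuzzy_chi S)) \<delta>"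
      using regular_quasi_ideal_eq[OF reg] by blast
  qed (rule regular_if_comp_eq_inter regular_if_idem_quasi regular_if_quasi_ideal_eq; simp)+
qed

end
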